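(* Let $q$ be a prime power and let $h_0,h_1\in\mathbf{F}_{q^2}[x]$ be relatively prime polynomials with $h_1\ne 0$ and $\deg(h_0)<q+\deg(h_1)$. Let $W(x)\in\mathbf{F}_{q^2}[x]$ be a polynomial of degree $w>1$. If $W(x)$ divides $x^qh_1(x)-h_0(x)$, then $e_1$ is always $0$ in the descent relations for $W$. That is, for every nonsingular matrix $m\in\mathbf{F}_{q^2}^{2\times 2}$ for which the polynomial $N_{m,W}(x)$ is $w/2$-smooth, so that $m$ yields a descent relation with left-hand side $\prod_{i=1}^{q^2}(W(x)+\alpha_i)^{e_i}$ (up to a nonzero constant), one has $e_1=0$; in other words, $W(x)=W(x)+\alpha_1$ never appears as a factor on the left-hand side of a descent relation.
   Context: $\alpha_1=0,\alpha_2,\dots,\alpha_{q^2}$ is an enumeration of the elements of $\mathbf{F}_{q^2}$. A nonzero polynomial over $\mathbf{F}_{q^2}$ is $t$-smooth if all its irreducible factors over $\mathbf{F}_{q^2}$ have degree $\le t$. Let $\tilde W$ be the polynomial obtained from $W$ by raising each coefficient to the $q$-th power. For nonsingular $m=\begin{pmatrix}a&b\\c&d\end{pmatrix}$ over $\mathbf{F}_{q^2}$ one has the polynomial identity $$(cW+d)\prod_{\alpha\in\mathbf{F}_q}\big((aW+b)-\alpha(cW+d)\big)=(a^q\tilde W(x^q)+b^q)(cW+d)-(aW+b)(c^q\tilde W(x^q)+d^q).$$ Replacing $x^q$ by $h_0(x)/h_1(x)$ on the right gives the rational function $$R_{m,W}(x)=\big(a^q\tilde W(h_0/h_1)+b^q\big)(cW+d)-(aW+b)\big(c^q\tilde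 W(h_0/h_1)+d^q\big),$$ whose denominator is a power of $h_1$ up to cancellation (note that $h_1$ is invertible modulo $x^qh_1-h_0$, since $h_0$ and $h_1$ are relatively prime), and the left-hand side of the identity is congruent to $R_{m,W}$ modulo $x^qh_1(x)-h_0(x)$. $N_{m,W}(x)$ denotes the numerator of $R_{m,W}(x)$. If $N_{m,W}$ is $w/2$-smooth, the resulting congruence modulo $x^qh_1(x)-h_0(x)$ is called the descent relation given by $m$; it is used to express products of the $W+\alpha_i$ in terms of polynomials of smaller degree. The $q+1$ factors on its left-hand side are $cW+d$ and $(a-\alpha c)W+(b-\alpha d)$ for $\alpha\in\mathbf{F}_q$; each is a nonzero constant or a nonzero constant multiple of some $W+\beta$ with $\beta\in\mathbf{F}_{q^2}$. So, up to a nonzero constant, the left-hand side is $\prod_{i=1}^{q^2}(W(x)+\alpha_i)^{e_i}$, where $e_i\in\{0,1\}$, and $e_i=1$ exactly when one of the $q+1$ factors is a nonzero constant multiple of $W(x)+\alpha_i$.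
   Formalization: The formal theorem additionally assumes that W is not itself w/2-smooth (automatic for irreducible W); without this the claim fails, e.g. for h_0=0, h_1=1, W=x^2 and m the identity, where N=-x^2 is 1-smooth and e_1=1. *)

theory Defs
  imports
    "HOL-Analysis.Determinants"
    "HOL-Computational_Algebra.Polynomial_Factorial"
    "HOL-Number_Theory.Prime_Powers"
begin

text \<open>
  Throughout, the type \<^typ>\<open>'a\<close> of class \<^class>\<open>finite_field\<close> plays the role of
  $\mathbf{F}_{q^2}$: statements about it assume that it has $q^2$ elements.
\<close>

text \<open>The subfield with $q$ elements of a field with $q^2$ elements, as the fixed field of
  $\alpha \mapsto \alpha^q$.\<close>
definition Fq :: "nat \<Rightarrow> 'a::finite_field set" where
  "Fq q = {\<alpha>. \<alpha> ^ q = \<alpha>}"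

lemma CHAR_eq_prime:
  assumes "CARD('a::finite_field) = p ^ n" and "prime p"
  shows "CHAR('a) = p"
proof -
  have "(\<Sum>x\<in>UNIV. x + 1) = (\<Sum>x\<in>UNIV. x :: 'a)"
    by (rule sum.reindex_bij_witness[of _ "\<lambda>y. y - 1" "\<lambda>x. x + 1"]) auto
  hence "of_nat CARD('a) = (0 :: 'a)"
    by (simp add: sum.distrib)
  hence "CHAR('a) dvd p ^ n"
    by (simp only: of_nat_eq_0_iff_char_dvd assms(1))
  hence "CHAR('a) dvd p"
    using prime_dvd_power CHAR_prime by blast
  thus ?thesis
    using assms(2) CHAR_prime primes_dvd_imp_eq by blast
qed

lemma card_Fq:
  assumes "primepow q" "CARD('a::finite_field) = q ^ 2"
  shows "card (Fq q :: 'a set) = q"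
proof -
  obtain p k where pk: "prime p" "k > 0" "q = p ^ k"
    using assms(1) by (auto simp: primepow_def)
  have q: "q > 1" using primepow_gt_Suc_0[OF assms(1)] by simp
  have p: "CHAR('a) = p"
    by (rule CHAR_eq_prime[of p "k * 2"]) (use assms(2) pk in \<open>simp_all add: power_mult\<close>)
  have add: "(x + y) ^ q = x ^ q + y ^ q" for x y :: 'a
    by (rule freshmans_dream'[where n = k]) (use pk p in auto)
  have minus: "(x - y) ^ q = x ^ q - y ^ q" for x y :: 'a
    using add[of "x - y" y] by simp
  have qq: "(x ^ q) ^ q = x" for x :: 'a
    using finite_field_power_card_eq_same[of x] assms(2)
    by (simp add: power_mult[symmetric] power2_eq_square)
  have roots: "card {x :: 'a. x ^ q + s * x = 0} \<le> q" for s
  proof -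
    have deg: "degree (monom 1 q + monom s 1) = q"
      using q degree_monom_le[of s 1]
      by (subst degree_add_eq_left) (auto simp: degree_monom_eq intro: le_less_trans)
    hence "monom 1 q + monom s 1 \<noteq> 0" using q by auto
    from card_poly_roots_bound[OF this] show ?thesis
      by (simp only: deg) (simp add: poly_monom)
  qed
  define T :: "'a \<Rightarrow> 'a" where "T x = x ^ q - x" for x
  have "card {x. T x = y} = card (Fq q :: 'a set)" if y: "y \<in> range T" for y
  proof -
    obtain z where "y = T z" using y by auto
    hence "bij_betw (\<lambda>x. x - z) {x. T x = y} (Fq q)"
      by (intro bij_betwI[where g = "\<lambda>x. x + z"]) (auto simp: Fq_def T_def add minus algebra_simps)
    thus ?thesis by (rule bij_betw_same_card)
  qed
  hence "(\<Sum>y\<in>range T. card {x \<in> UNIV. T x = y}) = card (range T) * card (Fq q :: 'a set)"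
    by simp
  moreover have "(\<Sum>y\<in>range T. card {x \<in> UNIV. T x = y}) = q ^ 2"
    using sum.image_gen[of UNIV "\<lambda>_. 1::nat" T] assms(2) by simp
  ultimately have RK: "card (range T) * card (Fq q :: 'a set) = q ^ 2" by simp
  have "range T \<subseteq> {x. x ^ q + 1 * x = 0}"
    by (auto simp: T_def minus qq)
  then have R: "card (range T) \<le> q"
    by (rule order.trans[OF card_mono[OF finite] roots])
  have "Fq q = {x :: 'a. x ^ q + (-1) * x = 0}" by (auto simp: Fq_def)
  hence K: "card (Fq q :: 'a set) \<le> q" using roots[of "-1"] by simp
  have "q * q \<le> q * card (Fq q :: 'a set)"
    using RK mult_right_mono[OF R, of "card (Fq q :: 'a set)"] by (simp add: power2_eq_square)
  thus ?thesis using q K by simp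
qed

definition smooth_poly :: "real \<Rightarrow> 'a::field poly \<Rightarrow> bool" where
  "smooth_poly t p \<longleftrightarrow> p \<noteq> 0 \<and> (\<forall>f. irreducible f \<longrightarrow> f dvd p \<longrightarrow> real (degree f) \<le> t)"

text \<open>A polynomial \<open>W\<close> that is itself \<open>w/2\<close>-smooth has to be excluded: for \<open>h0 = 0\<close>, \<open>h1 = 1\<close>, \<open>W = x^2\<close>
  and the identity matrix, the numerator is \<open>- x^2\<close>, which is \<open>1\<close>-smooth, while \<open>W\<close> itself occurs
  on the left-hand side. Irreducible \<open>W\<close> of degree at least 1 are never excluded.\<close>
lemma irreducible_not_smooth:
  assumes "irreducible W" and "degree W > 0"
  shows "\<not> smooth_poly (real (degree W) / 2) W"
  using assms by (auto simp: smooth_poly_def intro!: exI[of _ W])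

definition twist :: "nat \<Rightarrow> 'a::field poly \<Rightarrow> 'a poly" where
  "twist q W = map_poly (\<lambda>c. c ^ q) W"

abbreviation const_fract :: "'a::field \<Rightarrow> 'a poly fract" where
  "const_fract c \<equiv> to_fract [:c:]"

text \<open>$p(r)$ for a polynomial $p$ over $K$ and a rational function $r \in K(x)$.\<close>
definition poly_fract :: "'a::field poly \<Rightarrow> 'a poly fract \<Rightarrow> 'a poly fract" where
  "poly_fract p r = poly (map_poly const_fract p) r"

definition descent_fract ::
  "nat \<Rightarrow> 'a::finite_field poly \<Rightarrow> 'a poly \<Rightarrow> 'a^2^2 \<Rightarrow> 'a poly \<Rightarrow> 'a poly fract" where
  "descent_fract q h0 h1 m W =
     (let a = m $ 1 $ 1; b = m $ 1 $ 2; c = m $ 2 $ 1; d = m $ 2 $ 2;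
          V = poly_fract (twist q W) (Fract h0 h1)
      in (const_fract (a ^ q) * V + const_fract (b ^ q)) * to_fract (smult c W + [:d:])
         - to_fract (smult a W + [:b:]) * (const_fract (c ^ q) * V + const_fract (d ^ q)))"

text \<open>The numerator of a rational function in lowest terms is determined only up to a nonzero
  constant factor, so it is a relation.\<close>
definition is_numerator :: "'a::field poly fract \<Rightarrow> 'a poly \<Rightarrow> bool" where
  "is_numerator r N \<longleftrightarrow> (\<exists>D. D \<noteq> 0 \<and> coprime N D \<and> r = Fract N D)"

text \<open>The $q + 1$ factors $cW + d$ and $(aW + b) - \alpha(cW + d)$ with
  $\alpha \in \mathbf{F}_q$.\<close>
definition lhs_factors :: "nat \<Rightarrow> 'a::finite_field^2^2 \<Rightarrow> 'a poly \<Rightarrow> 'a poly set" where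
  "lhs_factors q m W =
     (let a = m $ 1 $ 1; b = m $ 1 $ 2; c = m $ 2 $ 1; d = m $ 2 $ 2
      in insert (smult c W + [:d:])
           ((\<lambda>\<alpha>. (smult a W + [:b:]) - smult \<alpha> (smult c W + [:d:])) ` Fq q))"

text \<open>The exponent of $W + \beta$ in the product of these factors.\<close>
definition lhs_exponent :: "nat \<Rightarrow> 'a::finite_field^2^2 \<Rightarrow> 'a poly \<Rightarrow> 'a \<Rightarrow> nat" where
  "lhs_exponent q m W \<beta> =
     (if \<exists>f \<in> lhs_factors q m W. \<exists>k. k \<noteq> 0 \<and> f = smult k (W + [:\<beta>:]) then 1 else 0)"

end

theory Submission
  imports Defs
begin

text \<open>
  Modulo \<open>W\<close> one has $h_0 \equiv x^q h_1$, so $\tilde W(h_0/h_1)$ becomes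
  $\tilde W(x^q) = W^q \equiv 0$ and $R_{m,W}$ becomes the constant $b^q d - b d^q$. If \<open>W\<close> is one of
  the factors on the left, then \<open>d = 0\<close> or $b = \alpha d$ with $\alpha^q = \alpha$; in both cases
  that constant vanishes. Since $h_1$ is coprime to \<open>W\<close>, it follows that every
  irreducible factor of \<open>W\<close> divides the numerator, which would make \<open>W\<close> itself smooth.
\<close>

text \<open>Since \<open>q\<close> is a power of the characteristic, the \<open>q\<close>-th power
  map is additive on polynomials as well, so it can be applied one coefficient at a time.\<close>

lemma pcompose_twist_monom:
  fixes W :: "'a::finite_field poly"
  assumes "primepow q" and "CARD('a) = q ^ 2"
  shows "pcompose (twist q W) (monom 1 q) = W ^ q"
proof -
  obtain p k where pk: "prime p" "k > 0" "q = p ^ k"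
    using assms(1) by (auto simp: primepow_def)
  have "CHAR('a) = p"
    by (rule CHAR_eq_prime[of p "k * 2"]) (use assms(2) pk in \<open>simp_all add: power_mult\<close>)
  hence add: "(f + g) ^ q = f ^ q + g ^ q" for f g :: "'a poly"
    by (intro freshmans_dream'[where n = k]) (use pk in auto)
  have q: "q > 0" using pk by (simp add: prime_gt_0_nat)
  show ?thesis
  proof (induction W)
    case 0
    show ?case using q by (simp add: twist_def)
  next
    case (pCons a W)
    have "twist q (pCons a W) = pCons (a ^ q) (twist q W)"
      using q by (simp add: twist_def map_poly_pCons)
    \<comment> \<open>Frobenius turns this decomposition into
      \<open>[:a ^ q:] + monom 1 q * W ^ q\<close>, which is the recursion of
      \<open>pcompose\<close> at \<open>monom 1 q\<close>.\<close>
    moreover have "pCons a W = [:a:] + monom 1 1 * W"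
      by (simp add: monom_altdef)
    ultimately show ?case
      by (simp add: pcompose_pCons pCons.IH add power_mult_distrib monom_power poly_const_pow)
  qed
qed

text \<open>Horner evaluation at \<open>h0 / h1\<close>: each step costs one more factor
  \<open>h1\<close>, and modulo \<open>W\<close> the numerator \<open>h0\<close> acts as
  \<open>s * h1\<close>. This transfers the substitution of \<open>s\<close> to the rational
  function without leaving the polynomial ring.\<close>

lemma poly_fract_clear_denominator:
  fixes p h0 h1 s W :: "'a::field poly"
  assumes "h1 \<noteq> 0" and "W dvd s * h1 - h0"
  obtains n P where "poly_fract p (Fract h0 h1) * to_fract (h1 ^ n) = to_fract P"
    and "W dvd P - h1 ^ n * pcompose p s"
proof -
  have "\<exists>n P. poly_fract p (Fract h0 h1) * to_fract (h1 ^ n) = to_fract P \<and>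
      W dvd P - h1 ^ n * pcompose p s"
  proof (induction p)
    case 0
    show ?case by (rule exI[of _ 0], rule exI[of _ 0]) (simp add: poly_fract_def)
  next
    case (pCons a p)
    then obtain n P where IH: "poly_fract p (Fract h0 h1) * to_fract (h1 ^ n) = to_fract P"
      "W dvd P - h1 ^ n * pcompose p s" by blast
    let ?P = "[:a:] * h1 ^ Suc n + h0 * P"
    have pf: "poly_fract (pCons a p) r = const_fract a + r * poly_fract p r" for r
      by (simp add: poly_fract_def map_poly_pCons)
    have h: "Fract h0 h1 * to_fract h1 = to_fract h0"
      using assms(1) by (simp add: to_fract_def eq_fract)
    have "poly_fract (pCons a p) (Fract h0 h1) * to_fract (h1 ^ Suc n) =
        const_fract a * to_fract (h1 ^ Suc n) +
        (Fract h0 h1 * to_fract h1) * (poly_fract p (Fract h0 h1) * to_fract (h1 ^ n))"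
      by (simp add: pf algebra_simps)
    also have "\<dots> = to_fract ?P"
      by (simp only: h IH(1) to_fract_mult to_fract_add)
    finally have 1: "poly_fract (pCons a p) (Fract h0 h1) * to_fract (h1 ^ Suc n) = to_fract ?P" .
    \<comment> \<open>The new error is \<open>h0\<close> times the old one plus a multiple of
      \<open>s * h1 - h0\<close>; \<open>W\<close> divides both.\<close>
    have "?P - h1 ^ Suc n * pcompose (pCons a p) s =
        h0 * (P - h1 ^ n * pcompose p s) - (s * h1 - h0) * (h1 ^ n * pcompose p s)"
      by (simp add: pcompose_pCons algebra_simps)
    hence 2: "W dvd ?P - h1 ^ Suc n * pcompose (pCons a p) s"
      using IH(2) assms(2) by simp
    show ?case using 1 2 by blast
  qed
  thus thesis using that by blast
qed

lemma irreducible_dvd_descent_numerator: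
  fixes f h0 h1 W N :: "'a::finite_field poly"
  assumes "primepow q" and "CARD('a) = q ^ 2"
    and "coprime h0 h1" and "h1 \<noteq> 0"
    and "W dvd monom 1 q * h1 - h0"
    and "is_numerator (descent_fract q h0 h1 m W) N"
    and "irreducible f" and "f dvd W"
    and const: "(m $ 1 $ 2) ^ q * m $ 2 $ 2 = m $ 1 $ 2 * (m $ 2 $ 2) ^ q"
  shows "f dvd N"
proof -
  define a b c d where abcd: "a = m $ 1 $ 1" "b = m $ 1 $ 2" "c = m $ 2 $ 1" "d = m $ 2 $ 2"
  define V where "V = poly_fract (twist q W) (Fract h0 h1)"
  have q: "q > 0" using primepow_gt_Suc_0[OF assms(1)] by simp
  obtain n P where P: "V * to_fract (h1 ^ n) = to_fract P"
    "W dvd P - h1 ^ n * pcompose (twist q W) (monom 1 q)"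
    using poly_fract_clear_denominator[OF assms(4,5)] unfolding V_def by blast
  have "W dvd W ^ q" using q by simp
  hence "W dvd h1 ^ n * pcompose (twist q W) (monom 1 q)"
    by (simp add: pcompose_twist_monom[OF assms(1,2)])
  hence WP: "W dvd P" using P(2) by (simp add: dvd_diff_left_iff)
  \<comment> \<open>Each product in the descent fraction is linear in \<open>V\<close>, so the
    single power \<open>h1 ^ n\<close> clears all denominators.\<close>
  define Q where "Q = ([:a ^ q:] * P + [:b ^ q:] * h1 ^ n) * (smult c W + [:d:])
      - (smult a W + [:b:]) * ([:c ^ q:] * P + [:d ^ q:] * h1 ^ n)"
  have "descent_fract q h0 h1 m W * to_fract (h1 ^ n) =
     (const_fract (a ^ q) * (V * to_fract (h1 ^ n)) + const_fract (b ^ q) * to_fract (h1 ^ n))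
        * to_fract (smult c W + [:d:])
     - to_fract (smult a W + [:b:])
        * (const_fract (c ^ q) * (V * to_fract (h1 ^ n)) + const_fract (d ^ q) * to_fract (h1 ^ n))"
    unfolding descent_fract_def Let_def V_def abcd by (simp only: algebra_simps)
  also have "\<dots> = to_fract Q"
    unfolding Q_def P(1) by (simp only: to_fract_mult to_fract_add to_fract_diff)
  finally have R: "descent_fract q h0 h1 m W * to_fract (h1 ^ n) = to_fract Q" .
  have bd: "[:b ^ q:] * [:d:] = [:b:] * [:d ^ q:]"
    using const by (simp add: abcd mult.commute)
  have sc: "smult x W = [:x:] * W" for x by simp
  \<comment> \<open>Sorted into a multiple of \<open>P\<close>, a multiple of \<open>W\<close>, and
    the constant b^q d - b d^q times \<open>h1 ^ n\<close>; the last summand vanishes by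
    \<open>bd\<close>.\<close>
  have "Q = P * ([:a ^ q:] * (smult c W + [:d:]) - (smult a W + [:b:]) * [:c ^ q:])
      + W * (h1 ^ n * ([:c:] * [:b ^ q:] - [:a:] * [:d ^ q:]))
      + h1 ^ n * ([:b ^ q:] * [:d:] - [:b:] * [:d ^ q:])"
    unfolding Q_def sc by (simp only: algebra_simps)
  hence WQ: "W dvd Q" using WP by (simp add: bd del: mult_pCons_left mult_pCons_right)
  obtain D where D: "D \<noteq> 0" "descent_fract q h0 h1 m W = Fract N D"
    using assms(6) unfolding is_numerator_def by blast
  \<comment> \<open>Cross-multiplication: passing to lowest terms can remove from \<open>Q\<close>
    only factors of \<open>h1\<close>, and \<open>f\<close> is not one of them.\<close>
  have "N * h1 ^ n = Q * D"
    using R D by (simp add: to_fract_def eq_fract)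
  hence "f dvd N * h1 ^ n" using WQ assms(8) dvd_trans by auto
  moreover have "\<not> f dvd h1"
  proof
    assume f: "f dvd h1"
    have "f dvd monom 1 q * h1 - h0" using assms(5,8) dvd_trans by blast
    hence "f dvd h0" using f by (simp add: dvd_diff_right_iff)
    hence "is_unit f" using f assms(3) coprime_common_divisor by blast
    thus False using assms(7) irreducible_not_unit by blast
  qed
  moreover have "prime_elem f" using assms(7) by (rule field_poly_irreducible_imp_prime)
  ultimately show ?thesis
    using prime_elem_dvd_multD prime_elem_dvd_power by blast
qed

text \<open>Otherwise \<open>W\<close>, of positive degree, would divide a nonzero constant.\<close>

lemma smult_add_const_eq_smultD:
  fixes W :: "'a::field poly"
  assumes "smult r W + [:s:] = smult k W" and "degree W > 0"
  shows "s = 0"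
proof -
  have "[:s:] = smult (k - r) W"
    using assms(1) by (simp add: smult_diff_left algebra_simps)
  hence "W dvd [:s:]" by (simp add: dvd_smult)
  thus ?thesis using assms(2) by (metis dvd_imp_degree_le degree_pCons_0 leD pCons_eq_0_iff)
qed

lemma lhs_exponent_0_imp_const:
  assumes "lhs_exponent q m W 0 \<noteq> 0" and "degree W > 0" and "q > 0"
  shows "(m $ 1 $ 2) ^ q * m $ 2 $ 2 = m $ 1 $ 2 * (m $ 2 $ 2) ^ q"
proof -
  define a b c d where abcd: "a = m $ 1 $ 1" "b = m $ 1 $ 2" "c = m $ 2 $ 1" "d = m $ 2 $ 2"
  obtain f k where f: "f \<in> lhs_factors q m W" "f = smult k W"
    using assms(1) by (auto simp: lhs_exponent_def split: if_splits)
  from f(1) consider "f = smult c W + [:d:]"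
    | \<alpha> where "\<alpha> ^ q = \<alpha>" "f = (smult a W + [:b:]) - smult \<alpha> (smult c W + [:d:])"
    by (auto simp: lhs_factors_def Let_def abcd Fq_def)
  hence "b ^ q * d = b * d ^ q"
  proof cases
    case 1
    hence "d = 0" using f(2) assms(2) smult_add_const_eq_smultD by metis
    thus ?thesis using assms(3) by simp
  next
    case 2
    have "smult (a - \<alpha> * c) W + [:b - \<alpha> * d:] = f"
      unfolding 2(2) by (rule poly_eqI) (simp add: algebra_simps coeff_pCons split: nat.split)
    hence "smult (a - \<alpha> * c) W + [:b - \<alpha> * d:] = smult k W"
      using f(2) by simp
    hence "b - \<alpha> * d = 0" using assms(2) by (rule smult_add_const_eq_smultD)
    hence "b = \<alpha> * d" by simp
    \<comment> \<open>Both sides equal \<open>\<alpha> * d ^ (q + 1)\<close>, because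
      \<open>\<alpha> ^ q = \<alpha>\<close>.\<close>
    thus ?thesis using 2(1) by (simp add: power_mult_distrib algebra_simps)
  qed
  thus ?thesis by (simp add: abcd)
qed

theorem theorem3:
  fixes q w :: nat
    and h0 h1 W N :: "'a::finite_field poly"
    and \<alpha> :: "nat \<Rightarrow> 'a"
    and e :: "nat \<Rightarrow> nat"
    and m :: "'a^2^2"
  assumes "primepow q" and "CARD('a) = q ^ 2"
    and "coprime h0 h1" and "h1 \<noteq> 0" and "degree h0 < q + degree h1"
    and "degree W = w" and "w > 1"
    and "\<not> smooth_poly (real w / 2) W"
    and "W dvd monom 1 q * h1 - h0"
    and "bij_betw \<alpha> {1..q ^ 2} UNIV" and "\<alpha> 1 = 0"
    and "invertible m"
    and "is_numerator (descent_fract q h0 h1 m W) N"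
    and "smooth_poly (real w / 2) N"
    and "\<And>i. i \<in> {1..q ^ 2} \<Longrightarrow> e i = lhs_exponent q m W (\<alpha> i)"
  shows "e 1 = 0"
proof (rule ccontr)
  assume "e 1 \<noteq> 0"
  have q: "q > 0" using primepow_gt_Suc_0[OF assms(1)] by simp
  hence "1 \<in> {1..q ^ 2}" by (simp add: Suc_le_eq)
  hence "lhs_exponent q m W 0 \<noteq> 0" using assms(15)[of 1] assms(11) \<open>e 1 \<noteq> 0\<close> by simp
  hence "(m $ 1 $ 2) ^ q * m $ 2 $ 2 = m $ 1 $ 2 * (m $ 2 $ 2) ^ q"
    using lhs_exponent_0_imp_const[of q m W] q assms(6,7) by simp
  hence "f dvd N" if "irreducible f" "f dvd W" for f
    using irreducible_dvd_descent_numerator[OF assms(1-4,9,13) that] by blast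
  moreover have "W \<noteq> 0" using assms(6,7) by auto
  \<comment> \<open>Irreducible factors of \<open>W\<close> are irreducible factors of
    \<open>N\<close>, so they inherit its degree bound.\<close>
  ultimately have "smooth_poly (real w / 2) W"
    using assms(14) unfolding smooth_poly_def by blast
  thus False using assms(8) by contradiction
qed

end
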